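(* Let $(\alpha,\beta,\gamma)\in\{(1,4,9),(2,3,5),(2,3,7)\}$. For all integers $k\ge 2$ and $n\ge k(3k+1)/2$, we have ${\rm TP}_{\alpha,\beta,\gamma}^{k}(n)\ge 0$, with strict inequality except for the following cases, in which the value is $0$: \begin{align*} &{\rm TP}_{1,4,9}^{2}(n)=0\ \text{ for } n=21,24,25;\\ &{\rm TP}_{2,3,5}^{2}(n)=0\ \text{ for } n=20,23,\quad\text{and}\quad {\rm TP}_{2,3,5}^{k}\left(\tfrac{k(3k+1)}{2}+1\right)=0\ \text{ for all } k\ge 2;\\ &{\rm TP}_{2,3,7}^{2}(3j)=0\ \text{ for integers } 4\le j\le 9,\quad\text{and}\quad {\rm TP}_{2,3,7}^{k}\left(\tfrac{k(3k+1)}{2}+1\right)=0\ \text{ for all } k\ge 2. \end{align*}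
   Context: For distinct pairwise coprime integers $\alpha,\beta,\gamma\ge 1$ and an integer $k\ge 1$, the integers ${\rm TP}_{\alpha,\beta,\gamma}^{k}(n)$ ($n\ge 0$) are defined by the formal power series identity $$\sum_{n\ge 0}{\rm TP}_{\alpha,\beta,\gamma}^{k}(n)q^n=\frac{(-1)^k}{(1-q^\alpha)(1-q^\beta)(1-q^\gamma)}\sum_{j\ge k}(-1)^jq^{j(3j+1)/2}\left(1-q^{2j+1}\right).$$ *)

theory Defs
  imports "HOL-Analysis.Analysis"
begin

text \<open>
  The exponent \<open>j * (3 * j + 1)\<close> is always even, so \<open>div\<close> is exact here. The infinite sum is taken
  in the usual topology on formal power series, see \<open>TP_sum_summable\<close>.
\<close>
definition TP_gf :: "nat \<Rightarrow> nat \<Rightarrow> nat \<Rightarrow> nat \<Rightarrow> rat fps" where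
  "TP_gf \<alpha> \<beta> \<gamma> k =
     (-1) ^ k / ((1 - fps_X ^ \<alpha>) * (1 - fps_X ^ \<beta>) * (1 - fps_X ^ \<gamma>)) *
     (\<Sum>\<^sub>\<infinity>j\<in>{k..}. (-1) ^ j * fps_X ^ (j * (3 * j + 1) div 2) * (1 - fps_X ^ (2 * j + 1)))"

text \<open>
  The integer sequence whose generating function is \<open>TP_gf\<close>. The rational series \<open>TP_gf\<close> serves only
  to make division of power series available; existence and uniqueness of the sequence is
  \<open>TP_ex1\<close> below.
\<close>
definition TP :: "nat \<Rightarrow> nat \<Rightarrow> nat \<Rightarrow> nat \<Rightarrow> nat \<Rightarrow> int" where
  "TP \<alpha> \<beta> \<gamma> k = (THE t. Abs_fps (\<lambda>n. rat_of_int (t n)) = TP_gf \<alpha> \<beta> \<gamma> k)"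

lemma TP_summand_nth_eq_0:
  assumes "n < j"
  shows "fps_nth ((-1) ^ j * fps_X ^ (j * (3 * j + 1) div 2) * (1 - fps_X ^ (2 * j + 1)) :: rat fps) n = 0"
proof -
  have "2 * j \<le> j * (3 * j + 1)"
    by (cases j) auto
  hence *: "n < j * (3 * j + 1) div 2"
    using assms by linarith
  have "(-1) ^ j * fps_X ^ (j * (3 * j + 1) div 2) * (1 - fps_X ^ (2 * j + 1)) =
        (fps_X ^ (j * (3 * j + 1) div 2) * ((-1) ^ j * (1 - fps_X ^ (2 * j + 1))) :: rat fps)"
    by (simp only: mult_ac)
  thus ?thesis
    using * by (simp only: fps_X_power_mult_nth if_True)
qed

lemma TP_sum_has_sum:
  "((\<lambda>j. (-1) ^ j * fps_X ^ (j * (3 * j + 1) div 2) * (1 - fps_X ^ (2 * j + 1)) :: rat fps) has_sum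
     Abs_fps (\<lambda>n. \<Sum>j=k..n. fps_nth ((-1) ^ j * fps_X ^ (j * (3 * j + 1) div 2) * (1 - fps_X ^ (2 * j + 1))) n))
   {k..}"
  (is "(?F has_sum _) _")
proof (rule has_sum_fpsI)
  fix n :: nat
  have sub: "{j \<in> {k..}. fps_nth (?F j) n \<noteq> 0} \<subseteq> {k..n}"
  proof
    fix j
    assume "j \<in> {j \<in> {k..}. fps_nth (?F j) n \<noteq> 0}"
    hence "k \<le> j" "fps_nth (?F j) n \<noteq> 0"
      by auto
    thus "j \<in> {k..n}"
      using TP_summand_nth_eq_0[of n j] by (meson atLeastAtMost_iff not_le)
  qed
  show "finite {j \<in> {k..}. fps_nth (?F j) n \<noteq> 0}"
    by (rule finite_subset[OF sub]) auto
  show "fps_nth (Abs_fps (\<lambda>n. \<Sum>j=k..n. fps_nth (?F j) n)) n =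
        (\<Sum>j | j \<in> {k..} \<and> fps_nth (?F j) n \<noteq> 0. fps_nth (?F j) n)"
    unfolding fps_nth_Abs_fps by (rule sum.mono_neutral_right) (use sub in auto)
qed

lemma TP_sum_summable:
  "(\<lambda>j. (-1) ^ j * fps_X ^ (j * (3 * j + 1) div 2) * (1 - fps_X ^ (2 * j + 1)) :: rat fps)
     summable_on {k..}"
  unfolding summable_on_def using TP_sum_has_sum by blast

lemma fps_mult_nth_Ints:
  fixes F G :: "rat fps"
  assumes "\<And>n. fps_nth F n \<in> \<int>" "\<And>n. fps_nth G n \<in> \<int>"
  shows "fps_nth (F * G) n \<in> \<int>"
  unfolding fps_mult_nth by (intro Ints_sum Ints_mult assms)

lemma fps_inverse_nth_Ints:
  fixes G :: "rat fps"
  assumes G: "\<And>n. fps_nth G n \<in> \<int>" and G0: "fps_nth G 0 = 1"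
  shows "fps_nth (inverse G) n \<in> \<int>"
proof (induction n rule: less_induct)
  case (less n)
  show ?case
  proof (cases "n = 0")
    case True
    thus ?thesis using G0 by simp
  next
    case False
    have "G * inverse G = 1"
      using G0 by (simp add: inverse_mult_eq_1')
    hence "(\<Sum>i=0..n. fps_nth G i * fps_nth (inverse G) (n - i)) = 0"
      using False by (metis fps_mult_nth fps_one_nth)
    hence "fps_nth (inverse G) n = - (\<Sum>i=Suc 0..n. fps_nth G i * fps_nth (inverse G) (n - i))"
      using G0 by (subst (asm) sum.atLeast_Suc_atMost) auto
    also have "\<dots> \<in> \<int>"
      by (intro Ints_minus Ints_sum Ints_mult G less) auto
    finally show ?thesis .
  qed
qed

lemma TP_gf_nth_Ints:
  assumes "\<alpha> \<ge> 1" "\<beta> \<ge> 1" "\<gamma> \<ge> 1"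
  shows "fps_nth (TP_gf \<alpha> \<beta> \<gamma> k) n \<in> \<int>"
proof -
  have X: "fps_nth (1 - fps_X ^ m :: rat fps) i \<in> \<int>" for m i
    by simp
  have pow: "fps_nth ((-1) ^ m :: rat fps) i \<in> \<int>" for m i
    by (cases "even m") auto
  have Xp: "fps_nth (fps_X ^ m :: rat fps) i \<in> \<int>" for m i
    by simp
  define G :: "rat fps" where "G = (1 - fps_X ^ \<alpha>) * (1 - fps_X ^ \<beta>) * (1 - fps_X ^ \<gamma>)"
  have G: "fps_nth G i \<in> \<int>" for i
    unfolding G_def by (intro fps_mult_nth_Ints X)
  have G0: "fps_nth G 0 = 1"
    using assms by (simp add: G_def)
  have eq: "TP_gf \<alpha> \<beta> \<gamma> k = (-1) ^ k * inverse G *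
     Abs_fps (\<lambda>n. \<Sum>j=k..n. fps_nth ((-1) ^ j * fps_X ^ (j * (3 * j + 1) div 2) * (1 - fps_X ^ (2 * j + 1))) n)"
    unfolding TP_gf_def G_def[symmetric] infsumI[OF TP_sum_has_sum]
    using G0 by (subst fps_divide_unit) auto
  show ?thesis
    unfolding eq
    by (intro fps_mult_nth_Ints pow fps_inverse_nth_Ints G G0)
       (unfold fps_nth_Abs_fps, intro Ints_sum fps_mult_nth_Ints pow Xp X)
qed

lemma TP_ex1:
  assumes "\<alpha> \<ge> 1" "\<beta> \<ge> 1" "\<gamma> \<ge> 1"
  shows "\<exists>!t. Abs_fps (\<lambda>n. rat_of_int (t n)) = TP_gf \<alpha> \<beta> \<gamma> k"
proof (rule ex_ex1I)
  have "\<forall>n. \<exists>z. rat_of_int z = fps_nth (TP_gf \<alpha> \<beta> \<gamma> k) n"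
    using TP_gf_nth_Ints[OF assms] by (metis Ints_cases)
  then obtain t where "\<And>n. rat_of_int (t n) = fps_nth (TP_gf \<alpha> \<beta> \<gamma> k) n"
    by metis
  thus "\<exists>t. Abs_fps (\<lambda>n. rat_of_int (t n)) = TP_gf \<alpha> \<beta> \<gamma> k"
    by (intro exI[of _ t]) (simp add: fps_eq_iff)
next
  fix s t
  assume "Abs_fps (\<lambda>n. rat_of_int (s n)) = TP_gf \<alpha> \<beta> \<gamma> k"
         "Abs_fps (\<lambda>n. rat_of_int (t n)) = TP_gf \<alpha> \<beta> \<gamma> k"
  thus "s = t"
    by (metis (no_types, lifting) ext fps_nth_Abs_fps of_int_eq_iff)
qed

lemma TP_gf_eq:
  assumes "\<alpha> \<ge> 1" "\<beta> \<ge> 1" "\<gamma> \<ge> 1"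
  shows "Abs_fps (\<lambda>n. rat_of_int (TP \<alpha> \<beta> \<gamma> k n)) = TP_gf \<alpha> \<beta> \<gamma> k"
  unfolding TP_def by (rule theI'[OF TP_ex1[OF assms]])

end

theory Submission
  imports Defs
begin

text \<open>
  Let \<open>p\<close> count the partitions into parts \<open>\<alpha>, \<beta>, \<gamma>\<close>, let \<open>a\<^sub>k = k (3 k + 1) / 2\<close>, and write
  \<open>T\<^sub>k(x)\<close> for the coefficient at \<open>a\<^sub>k + x\<close>. Then
  \<open>T\<^sub>k(x) = p(x) - p(x - (2 k + 1)) - T\<^sub>k\<^sub>+\<^sub>1(x - (3 k + 2))\<close>, and \<open>2 \<alpha> \<beta> \<gamma> p(x)\<close> differs from
  \<open>x\<^sup>2 + s x\<close>, \<open>s = \<alpha> + \<beta> + \<gamma>\<close>, by a periodic function. If this function is ignored, the recurrence is solved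
  by \<open>F\<^sub>k(x) = k (2 x + k + 2 + s)\<close>, because
  \<open>F\<^sub>k(x) + F\<^sub>k\<^sub>+\<^sub>1(x - (3 k + 2)) = (2 k + 1) (2 x - 2 k - 1 + s)\<close>. The accumulated error is at most about
  \<open>2 J\<^sup>2 + 97 (J - k)\<close>, where \<open>J\<close> is the last index with \<open>a\<^sub>J \<le> a\<^sub>k + x\<close>, whereas \<open>F\<^sub>k(x)\<close> is at least
  about \<open>3 k (J\<^sup>2 - k\<^sup>2)\<close>. This leaves finitely many cases with \<open>k \<le> 6\<close>, which are computed, and the range
  \<open>x < 3 k + 2\<close> for \<open>k \<ge> 7\<close>, where \<open>T\<^sub>k(x) = p(x) - p(x - (2 k + 1))\<close>.
\<close>

section \<open>The recurrence\<close>

text \<open>The coefficients of the power series of \<open>f\<close> divided by \<open>1 - q\<^sup>d\<close>.\<close>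
fun accum :: "nat \<Rightarrow> (nat \<Rightarrow> int) \<Rightarrow> nat \<Rightarrow> int" where
  "accum d f n = f n + (if 0 < d \<and> d \<le> n then accum d f (n - d) else 0)"

declare accum.simps [simp del]

definition parts3 :: "nat \<Rightarrow> nat \<Rightarrow> nat \<Rightarrow> nat \<Rightarrow> int" where
  "parts3 \<alpha> \<beta> \<gamma> = accum \<gamma> (accum \<beta> (accum \<alpha> (\<lambda>n. if n = 0 then 1 else 0)))"

text \<open>The guards put 0 at negative arguments, where subtraction on \<open>nat\<close> would
  truncate. With \<open>p\<close> as a parameter, the same operator applies to other inputs than
  \<open>parts3\<close>, such as \<open>delta\<close>.\<close>

fun tail :: "(nat \<Rightarrow> int) \<Rightarrow> nat \<Rightarrow> nat \<Rightarrow> int" where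
  "tail p k x = p x - (if x < 2 * k + 1 then 0 else p (x - (2 * k + 1)))
     - (if x < 3 * k + 2 then 0 else tail p (Suc k) (x - (3 * k + 2)))"

declare tail.simps [simp del]

definition pent :: "nat \<Rightarrow> nat" where
  "pent k = k * (3 * k + 1) div 2"

lemma two_pent: "2 * pent k = k * (3 * k + 1)"
  unfolding pent_def by simp

lemma pent_Suc: "pent (Suc k) = pent k + (3 * k + 2)"
proof -
  have "2 * pent (Suc k) = 2 * (pent k + (3 * k + 2))"
    unfolding distrib_left two_pent by (simp add: algebra_simps)
  thus ?thesis by simp
qed

lemma pent_mono: "k \<le> j \<Longrightarrow> pent k \<le> pent j"
  unfolding pent_def by (intro div_le_mono mult_le_mono) auto

lemma accum_rec: "d > 0 \<Longrightarrow> accum d f n = f n + (if n < d then 0 else accum d f (n - d))"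
  by (subst accum.simps) simp

section \<open>Generating functions and the recurrence for their coefficients\<close>

lemma fps_accum:
  assumes "d > 0"
  shows "Abs_fps (\<lambda>n. rat_of_int (accum d f n)) * (1 - fps_X ^ d) = Abs_fps (\<lambda>n. rat_of_int (f n))"
proof (rule fps_ext)
  fix n
  show "fps_nth (Abs_fps (\<lambda>n. rat_of_int (accum d f n)) * (1 - fps_X ^ d)) n
      = fps_nth (Abs_fps (\<lambda>n. rat_of_int (f n))) n"
    using accum_rec[OF assms, of f n]
    by (simp add: right_diff_distrib fps_X_power_mult_right_nth)
qed

text \<open>Multiplying with a factor undoes the corresponding \<open>accum\<close>; undoing all
  three leads back to the series 1.\<close>

lemma fps_parts3:
  assumes "\<alpha> \<ge> 1" "\<beta> \<ge> 1" "\<gamma> \<ge> 1"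
  shows "Abs_fps (\<lambda>n. rat_of_int (parts3 \<alpha> \<beta> \<gamma> n))
    = inverse ((1 - fps_X ^ \<alpha>) * (1 - fps_X ^ \<beta>) * (1 - fps_X ^ \<gamma>))"
proof -
  let ?P = "Abs_fps (\<lambda>n. rat_of_int (parts3 \<alpha> \<beta> \<gamma> n))"
  have "?P * (1 - fps_X ^ \<gamma>) * (1 - fps_X ^ \<beta>) * (1 - fps_X ^ \<alpha>)
      = Abs_fps (\<lambda>n. rat_of_int (if n = 0 then 1 else 0))"
    using assms unfolding parts3_def by (simp only: fps_accum)
  also have "\<dots> = 1"
    by (simp add: fps_eq_iff)
  finally have "((1 - fps_X ^ \<alpha>) * (1 - fps_X ^ \<beta>) * (1 - fps_X ^ \<gamma>)) * ?P = 1"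
    by (simp only: mult_ac)
  thus ?thesis
    by (metis fps_inverse_unique)
qed

definition pent_term :: "nat \<Rightarrow> rat fps" where
  "pent_term j = (-1) ^ j * fps_X ^ pent j * (1 - fps_X ^ (2 * j + 1))"

definition pent_tail :: "nat \<Rightarrow> rat fps" where
  "pent_tail k = (\<Sum>\<^sub>\<infinity>j\<in>{k..}. pent_term j)"

lemma pent_tail_nth: "fps_nth (pent_tail k) n = (\<Sum>j=k..n. fps_nth (pent_term j) n)"
  unfolding pent_tail_def pent_term_def pent_def infsumI[OF TP_sum_has_sum] by simp

lemma pent_tail_Suc: "pent_tail k = pent_term k + pent_tail (Suc k)"
proof (rule fps_ext)
  fix n
  show "fps_nth (pent_tail k) n = fps_nth (pent_term k + pent_tail (Suc k)) n"
  proof (cases "k \<le> n")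
    case True
    thus ?thesis
      by (simp add: pent_tail_nth sum.atLeast_Suc_atMost)
  next
    case False
    thus ?thesis
      using TP_summand_nth_eq_0[of n k] by (simp add: pent_tail_nth pent_term_def pent_def)
  qed
qed

text \<open>Sharper than \<open>TP_summand_nth_eq_0\<close>, whose threshold is only
  \<open>j\<close>.\<close>

lemma pent_term_nth_eq_0:
  assumes "n < pent j"
  shows "fps_nth (pent_term j) n = 0"
proof -
  have "pent_term j = fps_X ^ pent j * ((-1) ^ j * (1 - fps_X ^ (2 * j + 1)))"
    unfolding pent_term_def by (simp only: mult_ac)
  thus ?thesis
    using assms by (simp only: fps_X_power_mult_nth if_True)
qed

lemma pent_tail_nth_eq_0:
  assumes "n < pent k"
  shows "fps_nth (pent_tail k) n = 0"
  unfolding pent_tail_nth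
proof (intro sum.neutral ballI)
  fix j assume "j \<in> {k..n}"
  hence "pent k \<le> pent j"
    by (intro pent_mono) auto
  thus "fps_nth (pent_term j) n = 0"
    using assms by (intro pent_term_nth_eq_0) linarith
qed

context
  fixes \<alpha> \<beta> \<gamma> :: nat
  assumes pos: "\<alpha> \<ge> 1" "\<beta> \<ge> 1" "\<gamma> \<ge> 1"
begin

lemma TP_gf_alt:
  "TP_gf \<alpha> \<beta> \<gamma> k = Abs_fps (\<lambda>n. rat_of_int (parts3 \<alpha> \<beta> \<gamma> n)) * ((-1) ^ k * pent_tail k)"
proof -
  have "fps_nth ((1 - fps_X ^ \<alpha>) * (1 - fps_X ^ \<beta>) * (1 - fps_X ^ \<gamma>) :: rat fps) 0 = 1"
    using pos by simp
  hence "TP_gf \<alpha> \<beta> \<gamma> k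
      = (-1) ^ k * inverse ((1 - fps_X ^ \<alpha>) * (1 - fps_X ^ \<beta>) * (1 - fps_X ^ \<gamma>)) * pent_tail k"
    unfolding TP_gf_def pent_tail_def pent_term_def pent_def by (subst fps_divide_unit) auto
  thus ?thesis
    unfolding fps_parts3[OF pos] by (simp only: mult_ac)
qed

lemma of_int_TP: "rat_of_int (TP \<alpha> \<beta> \<gamma> k n) = fps_nth (TP_gf \<alpha> \<beta> \<gamma> k) n"
  by (simp flip: TP_gf_eq[OF pos])

lemma TP_eq_0:
  assumes "n < pent k"
  shows "TP \<alpha> \<beta> \<gamma> k n = 0"
proof -
  have "fps_nth ((-1) ^ k * pent_tail k) i = 0" if "i \<le> n" for i
    using that assms pent_tail_nth_eq_0[of i k] by (cases "even k") auto
  hence "fps_nth (TP_gf \<alpha> \<beta> \<gamma> k) n = 0"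
    unfolding TP_gf_alt by (subst fps_mult_nth) (simp add: sum.neutral)
  thus ?thesis
    by (simp flip: of_int_TP)
qed

text \<open>The signs \<open>(-1) ^ k\<close> and \<open>(-1) ^ Suc k\<close> are opposite, so
  adding the two series cancels \<open>pent_tail (Suc k)\<close> and leaves only the summand with
  index \<open>k\<close>.\<close>

lemma TP_Suc:
  "TP \<alpha> \<beta> \<gamma> k n + TP \<alpha> \<beta> \<gamma> (Suc k) n
    = (if n < pent k then 0 else parts3 \<alpha> \<beta> \<gamma> (n - pent k))
    - (if n < pent k + (2 * k + 1) then 0 else parts3 \<alpha> \<beta> \<gamma> (n - (pent k + (2 * k + 1))))"
proof -
  let ?P = "Abs_fps (\<lambda>n. rat_of_int (parts3 \<alpha> \<beta> \<gamma> n))"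
  have sq: "(-1) ^ k * pent_term k = fps_X ^ pent k * (1 - fps_X ^ (2 * k + 1))"
    unfolding pent_term_def mult.assoc[symmetric] power_mult_distrib[symmetric] by simp
  have "TP_gf \<alpha> \<beta> \<gamma> k + TP_gf \<alpha> \<beta> \<gamma> (Suc k) = ?P * ((-1) ^ k * pent_term k)"
    unfolding TP_gf_alt pent_tail_Suc[of k] by (simp add: algebra_simps)
  also have "\<dots> = ?P * fps_X ^ pent k - ?P * fps_X ^ (pent k + (2 * k + 1))"
    unfolding sq by (simp only: power_add) (simp add: algebra_simps)
  finally have "fps_nth (TP_gf \<alpha> \<beta> \<gamma> k + TP_gf \<alpha> \<beta> \<gamma> (Suc k)) n
      = fps_nth (?P * fps_X ^ pent k - ?P * fps_X ^ (pent k + (2 * k + 1))) n"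
    by simp
  hence "rat_of_int (TP \<alpha> \<beta> \<gamma> k n + TP \<alpha> \<beta> \<gamma> (Suc k) n)
    = rat_of_int ((if n < pent k then 0 else parts3 \<alpha> \<beta> \<gamma> (n - pent k))
    - (if n < pent k + (2 * k + 1) then 0 else parts3 \<alpha> \<beta> \<gamma> (n - (pent k + (2 * k + 1)))))"
    by (simp only: fps_add_nth fps_sub_nth fps_X_power_mult_right_nth of_int_add of_int_diff of_int_TP
        fps_nth_Abs_fps) simp
  thus ?thesis
    by (simp only: of_int_eq_iff)
qed

text \<open>This is \<open>TP_Suc\<close> with arguments counted from \<open>pent k\<close>. As
  \<open>pent (Suc k)\<close> lies \<open>3 * k + 2\<close> higher, the next level is read at
  \<open>x - (3 * k + 2)\<close>, and it vanishes by \<open>TP_eq_0\<close> if that is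
  negative.\<close>

lemma TP_eq_tail: "TP \<alpha> \<beta> \<gamma> k (pent k + x) = tail (parts3 \<alpha> \<beta> \<gamma>) k x"
proof (induction x arbitrary: k rule: less_induct)
  case (less x)
  show ?case
  proof (cases "x < 3 * k + 2")
    case True
    hence "TP \<alpha> \<beta> \<gamma> (Suc k) (pent k + x) = 0"
      by (intro TP_eq_0) (unfold pent_Suc, simp)
    thus ?thesis
      using TP_Suc[of k "pent k + x"] True by (subst tail.simps) auto
  next
    case False
    hence "pent k + x = pent (Suc k) + (x - (3 * k + 2))"
      unfolding pent_Suc by simp
    hence "TP \<alpha> \<beta> \<gamma> (Suc k) (pent k + x) = tail (parts3 \<alpha> \<beta> \<gamma>) (Suc k) (x - (3 * k + 2))"
      using False less.IH[of "x - (3 * k + 2)" "Suc k"] by simp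
    thus ?thesis
      using TP_Suc[of k "pent k + x"] False by (subst tail.simps) auto
  qed
qed

end

section \<open>The estimate\<close>

text \<open>\<open>N\<close> stands for \<open>2 \<alpha> \<beta> \<gamma>\<close> and
  \<open>s\<close> for \<open>\<alpha> + \<beta> + \<gamma>\<close>, which is 14, 10 or 12. The
  error bounds -13 and 84 serve all three triples at once.\<close>

context
  fixes p :: "nat \<Rightarrow> int" and N s :: int
  assumes N: "N > 0" and p_0: "p 0 = 1" and s: "10 \<le> s" "s \<le> 14"
    and lower: "\<And>x. int x ^ 2 + s * int x - 13 \<le> N * p x"
    and upper: "\<And>x. N * p x \<le> int x ^ 2 + s * int x + 84"
begin

text \<open>The quadratic parts differ by exactly this product; 97 = 84 + 13 is the width of the
  error interval.\<close>

lemma difference_bounds: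
  assumes "2 * k + 1 \<le> x"
  shows "\<bar>N * p x - N * p (x - (2 * k + 1)) - (2 * int k + 1) * (2 * int x - 2 * int k - 1 + s)\<bar> \<le> 97"
proof -
  define y where "y = x - (2 * k + 1)"
  have x: "int x = int y + 2 * int k + 1"
    using assms by (simp add: y_def)
  have "int x ^ 2 + s * int x - (int y ^ 2 + s * int y) = (2 * int k + 1) * (2 * int x - 2 * int k - 1 + s)"
    unfolding x by (simp add: algebra_simps power2_eq_square)
  thus ?thesis
    using lower[of x] lower[of y] upper[of x] upper[of y] unfolding y_def[symmetric] by linarith
qed

text \<open>Induction along the recurrence: \<open>J\<close> is the level where it stops and
  \<open>r\<close> the argument there, so that \<open>pent k + x = pent J + r\<close>. The last
  level has error at most \<open>2 J^2 + 2 J + 165\<close>, and each earlier one adds at most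
  97.\<close>

lemma tail_estimate:
  "\<exists>J r. k \<le> J \<and> r < 3 * J + 2 \<and> 2 * x + k * (3 * k + 1) = J * (3 * J + 1) + 2 * r \<and>
     \<bar>N * tail p k x - int k * (2 * int x + int k + 2 + s)\<bar>
       \<le> 2 * int J ^ 2 + 2 * int J + 165 + 97 * (int J - int k)"
proof (induction x arbitrary: k rule: less_induct)
  case (less x)
  consider "x < 2 * k + 1" | "2 * k + 1 \<le> x" "x < 3 * k + 2" | "3 * k + 2 \<le> x"
    by linarith
  thus ?case
  proof cases
    case 1
    define y where "y = int x - int k"
    have y: "\<bar>y\<bar> \<le> int k"
      using 1 by (simp add: y_def)
    have t: "tail p k x = p x"
      using 1 by (subst tail.simps) simp
    define F where "F = int k * (2 * int x + int k + 2 + s)"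
    have e: "int x ^ 2 + s * int x - F
        = y ^ 2 + s * y - 2 * int k ^ 2 - 2 * int k"
      unfolding y_def F_def by (simp add: algebra_simps power2_eq_square)
    have "y ^ 2 \<le> int k ^ 2"
      using y by (metis abs_ge_zero power2_abs power_mono)
    moreover have "s * y \<le> s * int k"
      using y s by (intro mult_left_mono) auto
    moreover have "s * int k \<le> 14 * int k"
      using s by (intro mult_right_mono) auto
    \<comment> \<open>Completing the square: the minimum is \<open>- s^2 / 4\<close>, and
      \<open>s \<le> 14\<close>.\<close>
    moreover have "-49 \<le> y ^ 2 + s * y"
    proof -
      have "s ^ 2 \<le> 14 ^ 2"
        using s by (intro power_mono) auto
      moreover have "0 \<le> (2 * y + s) ^ 2"
        by simp
      ultimately show ?thesis
        by (simp add: algebra_simps power2_eq_square)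
    qed
    moreover have "0 \<le> (int k - 6) ^ 2"
      by simp
    hence "12 * int k \<le> int k ^ 2 + 36"
      by (simp add: algebra_simps power2_eq_square)
    moreover have "0 \<le> int k ^ 2" by simp
    ultimately have "\<bar>N * tail p k x - int k * (2 * int x + int k + 2 + s)\<bar>
       \<le> 2 * int k ^ 2 + 2 * int k + 165"
      using lower[of x] upper[of x] e unfolding t F_def[symmetric] by linarith
    moreover have "x < 3 * k + 2" using 1 by simp
    ultimately show ?thesis
      by (intro exI[of _ k] exI[of _ x]) (auto simp del: abs_le_iff)
  next
    case 2
    have t: "tail p k x = p x - p (x - (2 * k + 1))"
      using 2 by (subst tail.simps) simp
    define y where "y = 2 * int x - 5 * int k - 1 + s"
    have y: "int k * -1 + 11 \<le> y" "y \<le> int k + 15"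
      using 2 s by (auto simp: y_def)
    have e: "(2 * int k + 1) * (2 * int x - 2 * int k - 1 + s) - int k * (2 * int x + int k + 2 + s)
        = (int k + 1) * y"
      unfolding y_def by (simp add: algebra_simps power2_eq_square)
    have "(int k + 1) * y \<le> (int k + 1) * (int k + 15)"
         "(int k + 1) * (int k * -1 + 11) \<le> (int k + 1) * y"
      using y by (intro mult_left_mono; simp)+
    \<comment> \<open>Needed for \<open>(k + 1) (k + 15) \<le> 2 k^2 + 2 k + 68\<close>. The
      constant 165 is 68 plus the 97 of \<open>difference_bounds\<close>.\<close>
    moreover have "0 \<le> (int k - 7) ^ 2"
      by simp
    ultimately have "(int k + 1) * y \<le> 2 * int k ^ 2 + 2 * int k + 68"
       "- (2 * int k ^ 2 + 2 * int k + 68) \<le> (int k + 1) * y"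
      by (simp_all add: algebra_simps power2_eq_square)
    hence "\<bar>N * tail p k x - int k * (2 * int x + int k + 2 + s)\<bar>
       \<le> 2 * int k ^ 2 + 2 * int k + 165"
      using difference_bounds[OF 2(1)] e unfolding t right_diff_distrib by linarith
    thus ?thesis
      using 2 by (intro exI[of _ k] exI[of _ x]) (auto simp del: abs_le_iff)
  next
    case 3
    define y where "y = x - (3 * k + 2)"
    have x: "x = y + 3 * k + 2"
      using 3 by (simp add: y_def)
    have t: "tail p k x = p x - p (x - (2 * k + 1)) - tail p (Suc k) y"
      using 3 by (subst tail.simps) (simp add: y_def)
    obtain J r where J: "Suc k \<le> J" "r < 3 * J + 2"
        "2 * y + Suc k * (3 * Suc k + 1) = J * (3 * J + 1) + 2 * r"
        "\<bar>N * tail p (Suc k) y - int (Suc k) * (2 * int y + int (Suc k) + 2 + s)\<bar>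
       \<le> 2 * int J ^ 2 + 2 * int J + 165 + 97 * (int J - int (Suc k))"
      using less.IH[of y "Suc k"] 3 by (auto simp: y_def)
    \<comment> \<open>The main terms solve the recurrence exactly, so only the errors add up:
      \<open>97 (J - (k + 1)) + 97 = 97 (J - k)\<close>.\<close>
    have "int k * (2 * int x + int k + 2 + s) + int (Suc k) * (2 * int y + int (Suc k) + 2 + s)
        = (2 * int k + 1) * (2 * int x - 2 * int k - 1 + s)"
      unfolding x by (simp add: algebra_simps power2_eq_square)
    hence "\<bar>N * tail p k x - int k * (2 * int x + int k + 2 + s)\<bar>
       \<le> 2 * int J ^ 2 + 2 * int J + 165 + 97 * (int J - int k)"
      using difference_bounds[of k x] J(4) 3 unfolding t right_diff_distrib by simp
    moreover have "2 * x + k * (3 * k + 1) = J * (3 * J + 1) + 2 * r"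
      using J(3) unfolding x by (simp add: algebra_simps)
    ultimately show ?thesis
      using J(1,2) by (intro exI[of _ J] exI[of _ r]) auto
  qed
qed

text \<open>The main term must exceed the error of \<open>tail_estimate\<close>; \<open>ineq\<close>
  compares bounds for both that involve only \<open>J\<close> and \<open>k\<close>. The bound on
  \<open>x\<close> forces \<open>J \<ge> b\<close>.\<close>

lemma tail_pos_if:
  fixes b :: int
  assumes x: "pent k + x \<ge> pent b'" and b: "b = int b'"
    and ineq: "\<And>J. J \<ge> b \<Longrightarrow>
      2 * J ^ 2 + 2 * J + 165 + 97 * (J - int k) < int k * (3 * (J ^ 2 - int k ^ 2) + J + 12)"
  shows "tail p k x > 0"
proof -
  obtain J r where J: "k \<le> J" "r < 3 * J + 2" "2 * x + k * (3 * k + 1) = J * (3 * J + 1) + 2 * r"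
    and est: "\<bar>N * tail p k x - int k * (2 * int x + int k + 2 + s)\<bar>
       \<le> 2 * int J ^ 2 + 2 * int J + 165 + 97 * (int J - int k)"
    using tail_estimate[of k x] by blast
  \<comment> \<open>\<open>pent k + x = pent J + r\<close> lies below
    \<open>pent (Suc J)\<close>.\<close>
  have "pent b' < pent (Suc J)"
    using x J(2,3) two_pent[of k] two_pent[of J] unfolding pent_Suc by linarith
  hence "b' \<le> J"
    using pent_mono[of "Suc J" b'] by (meson not_less not_less_eq_eq)
  hence 1: "2 * int J ^ 2 + 2 * int J + 165 + 97 * (int J - int k)
      < int k * (3 * (int J ^ 2 - int k ^ 2) + int J + 12)"
    by (intro ineq) (simp add: b)
  have "2 * int x + int k * (3 * int k + 1) = int J * (3 * int J + 1) + 2 * int r"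
    using arg_cong[OF J(3), of int] by (simp add: algebra_simps)
  \<comment> \<open>Drops \<open>2 r\<close> and uses \<open>2 + s \<ge> 12\<close>.\<close>
  hence "3 * (int J ^ 2 - int k ^ 2) + int J + 12 \<le> 2 * int x + int k + 2 + s"
    using s by (simp add: algebra_simps power2_eq_square)
  hence "int k * (3 * (int J ^ 2 - int k ^ 2) + int J + 12) \<le> int k * (2 * int x + int k + 2 + s)"
    by (rule mult_left_mono) simp
  hence "0 < N * tail p k x"
    using 1 est by linarith
  thus ?thesis
    using N by (simp add: zero_less_mult_iff)
qed

text \<open>For \<open>x \<ge> 3 * k + 2\<close> the index \<open>J\<close> is at least
  \<open>k + 1\<close> and the estimate suffices. Below that, at most two values of \<open>p\<close>
  occur and are compared directly. The argument 1 is excluded because \<open>p 1\<close> may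
  vanish.\<close>

lemma tail_pos_large_k:
  assumes k: "k \<ge> 7" and x: "x \<noteq> 1"
  shows "tail p k x > 0"
proof -
  have px: "p x > 0" 
  proof -
    consider "x = 0" | "x \<ge> 2"
      using x by linarith
    thus ?thesis
    proof cases
      case 2
      have "2 ^ 2 + 10 * 2 \<le> int x ^ 2 + s * int x"
        using 2 s by (intro add_mono power_mono mult_mono) auto
      hence "0 < N * p x"
        using lower[of x] by simp
      thus ?thesis
        using N by (simp add: zero_less_mult_iff)
    qed (simp add: p_0)
  qed
  consider "x < 2 * k + 1" | "2 * k + 1 \<le> x" "x < 3 * k + 2" | "3 * k + 2 \<le> x"
    by linarith
  thus ?thesis
  proof cases
    case 1
    thus ?thesis using px by (subst tail.simps) simp
  next
    case 2
    have t: "tail p k x = p x - p (x - (2 * k + 1))"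
      using 2 by (subst tail.simps) simp
    \<comment> \<open>The factors are least at \<open>k = 7\<close>, \<open>x = 2 * k + 1\<close>,
      \<open>s = 10\<close>, and 375 exceeds 97.\<close>
    have "15 * 25 \<le> (2 * int k + 1) * (2 * int x - 2 * int k - 1 + s)"
      using k 2 s by (intro mult_mono) auto
    hence "0 < N * tail p k x"
      using difference_bounds[OF 2(1)] unfolding t right_diff_distrib by linarith
    thus ?thesis
      using N by (simp add: zero_less_mult_iff)
  next
    case 3
    show ?thesis
    proof (rule tail_pos_if)
      show "pent (Suc k) \<le> pent k + x"
        using 3 unfolding pent_Suc by simp
    next
      fix J :: int
      assume "J \<ge> int (Suc k)"
      \<comment> \<open>With \<open>J = k + m\<close> and \<open>k = l + 7\<close>, the negative
        terms \<open>l^2 + 4 l + 144\<close> are dominated by the coefficient of \<open>m\<close>,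
        as \<open>m \<ge> 1\<close>.\<close>
      define m where "m = J - int k"
      have m: "m \<ge> 1" "J = int k + m" using \<open>J \<ge> int (Suc k)\<close> by (auto simp: m_def)
      define l where "l = int k - 7"
      have l: "l \<ge> 0" "int k = l + 7" using k by (auto simp: l_def)
      have "int k * (3 * (J ^ 2 - int k ^ 2) + J + 12) - (2 * J ^ 2 + 2 * J + 165 + 97 * (J - int k))
         = m * (6 * l^2 + 81 * l + 174) + m^2 * (3 * l + 19) - l^2 - 4 * l - 144"
        unfolding m(2) l(2) by (simp add: algebra_simps power2_eq_square)
      moreover have "0 < m * (6 * l^2 + 81 * l + 174) + m^2 * (3 * l + 19) - l^2 - 4 * l - 144"
      proof -
        have "6 * l^2 + 81 * l + 174 \<le> m * (6 * l^2 + 81 * l + 174)"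
          using m l mult_right_mono[of 1 m "6 * l^2 + 81 * l + 174"] by auto
        moreover have "0 \<le> m^2 * (3 * l + 19)" "0 \<le> l^2"
          using l by simp_all
        \<comment> \<open>Variables replace the nonlinear terms, which leaves a linear
          problem.\<close>
        moreover have "a > 0" if "6 * c + 81 * l + 174 \<le> a'" "0 \<le> b" "0 \<le> c"
            "a = a' + b - c - 4 * l - 144" for a a' b c :: int
          using that l by linarith
        ultimately show ?thesis
          by blast
      qed
      ultimately show "2 * J ^ 2 + 2 * J + 165 + 97 * (J - int k)
          < int k * (3 * (J ^ 2 - int k ^ 2) + J + 12)"
        by simp
    qed simp
  qed
qed

end

section \<open>The finitely many remaining cases\<close>

text \<open>The first list is a queue of the last \<open>d\<close> outputs, oldest first, so its
  head is the value \<open>d\<close> places back.\<close>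

fun accum_list :: "int list \<Rightarrow> int list \<Rightarrow> int list" where
  "accum_list (z # zs) (x # xs) = (x + z) # accum_list (zs @ [x + z]) xs"
| "accum_list _ _ = []"

text \<open>The induction needs an arbitrary start \<open>m\<close>; the queue then holds the values
  at \<open>m - d, ..., m - 1\<close>, with 0 at negative arguments.\<close>

lemma accum_list_correct:
  assumes "d > 0"
  shows "accum_list (map (\<lambda>i. if i < d then 0 else accum d f (i - d)) [m..<m + d]) (map f [m..<m + l])
    = map (accum d f) [m..<m + l]"
proof (induction l arbitrary: m)
  case 0
  show ?case by simp
next
  case (Suc l)
  let ?g = "\<lambda>i. if i < d then 0 else accum d f (i - d)"
  have 1: "[m..<m + d] = m # [Suc m..<m + d]" "[m..<m + Suc l] = m # [Suc m..<Suc m + l]"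
    using assms by (simp_all add: upt_conv_Cons)
  have "accum d f m = f m + ?g m"
    by (rule accum_rec[OF assms])
  moreover have "map ?g [Suc m..<m + d] @ [accum d f m] = map ?g [Suc m..<Suc m + d]"
    using assms by simp
  ultimately show ?case
    unfolding 1 list.map accum_list.simps using Suc.IH[of "Suc m"] by simp
qed

lemma accum_list_replicate:
  assumes "d > 0"
  shows "accum_list (replicate d 0) (map f [0..<l]) = map (accum d f) [0..<l]"
proof -
  have "replicate d 0 = map (\<lambda>i. if i < d then 0 else accum d f (i - d)) [0..<0 + d]"
    by (intro nth_equalityI) auto
  thus ?thesis
    using accum_list_correct[OF assms, of f 0 l] by simp
qed

definition parts3_list :: "nat \<Rightarrow> nat \<Rightarrow> nat \<Rightarrow> int list \<Rightarrow> int list" where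
  "parts3_list \<alpha> \<beta> \<gamma> xs = accum_list (replicate \<gamma> 0) (accum_list (replicate \<beta> 0)
     (accum_list (replicate \<alpha> 0) xs))"

abbreviation delta :: "nat \<Rightarrow> int" where
  "delta \<equiv> \<lambda>n. if n = 0 then 1 else 0"

lemma delta_list: "1 # replicate l 0 = map delta [0..<Suc l]"
  by (intro nth_equalityI) (auto simp: nth_Cons' simp del: upt_Suc)

lemma parts3_list_correct:
  assumes "\<alpha> > 0" "\<beta> > 0" "\<gamma> > 0"
  shows "parts3_list \<alpha> \<beta> \<gamma> (map f [0..<l]) = map (accum \<gamma> (accum \<beta> (accum \<alpha> f))) [0..<l]"
  unfolding parts3_list_def using assms by (simp only: accum_list_replicate)

lemma accum_unique:
  assumes "d > 0" and "\<And>n. g n = f n + (if n < d then 0 else g (n - d))"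
  shows "accum d f = g"
proof
  fix n
  show "accum d f n = g n"
  proof (induction n rule: less_induct)
    case (less n)
    thus ?case
      using assms(1) assms(2)[of n] accum_rec[of d f n] by simp
  qed
qed

text \<open>\<open>tail\<close> is linear in its input and commutes with shifts, hence with division
  by \<open>1 - q^d\<close>. By \<open>accum_unique\<close> only the recurrence must be checked,
  which is done for the terms at offsets 0, \<open>2 * k + 1\<close> and
  \<open>3 * k + 2\<close>.\<close>

lemma accum_tail:
  assumes d: "d > 0"
  shows "accum d (tail f k) = tail (accum d f) k"
proof (rule accum_unique[OF d])
  fix x
  let ?g = "accum d f"
  show "tail ?g k x = tail f k x + (if x < d then 0 else tail ?g k (x - d))"
  proof (induction x arbitrary: k rule: less_induct)
    case (less x)
    have IH: "tail ?g (Suc k) (x - (3 * k + 2)) = tail f (Suc k) (x - (3 * k + 2))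
        + (if x < 3 * k + 2 + d then 0 else tail ?g (Suc k) (x - d - (3 * k + 2)))" if "3 * k + 2 \<le> x"
      using less.IH[of "x - (3 * k + 2)" "Suc k"] that by (auto simp: diff_commute add.commute)
    have g: "?g (x - a) = f (x - a) + (if x < a + d then 0 else ?g (x - d - a))" if "a \<le> x" for a
      using accum_rec[OF d, of f "x - a"] that by (auto simp: diff_commute add.commute)
    show ?case
      using IH g[of 0] g[of "2 * k + 1"]
      by (simp add: tail.simps[of _ k x] tail.simps[of _ k "x - d"] less_diff_conv2)
  qed
qed

text \<open>The coefficients of \<open>X - q^d Y\<close>, cut off at the length of
  \<open>xs\<close>.\<close>

fun shift_diff :: "nat \<Rightarrow> int list \<Rightarrow> int list \<Rightarrow> int list" where
  "shift_diff 0 (x # xs) (y # ys) = (x - y) # shift_diff 0 xs ys"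
| "shift_diff 0 xs [] = xs"
| "shift_diff (Suc d) (x # xs) ys = x # shift_diff d xs ys"
| "shift_diff _ [] _ = []"

lemma length_shift_diff [simp]: "length (shift_diff d xs ys) = length xs"
  by (induction d xs ys rule: shift_diff.induct) auto

lemma nth_shift_diff:
  assumes "i < length xs" "length xs \<le> length ys + d"
  shows "shift_diff d xs ys ! i = xs ! i - (if i < d then 0 else ys ! (i - d))"
  using assms by (induction d xs ys arbitrary: i rule: shift_diff.induct) (auto simp: nth_Cons')

text \<open>Of \<open>l\<close> arguments only the first \<open>l - (3 * k + 2)\<close> matter at
  the next level; since \<open>length xs = l - 1\<close>, this is the number in
  \<open>take\<close>.\<close>

fun tail_list :: "nat \<Rightarrow> int list \<Rightarrow> int list" where
  "tail_list k [] = []"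
| "tail_list k (x # xs) = shift_diff (3 * k + 2) (shift_diff (2 * k + 1) (x # xs) (x # xs))
     (tail_list (Suc k) (take (length xs - (3 * k + 1)) (x # xs)))"

lemma tail_list_correct: "tail_list k (map p [0..<l]) = map (tail p k) [0..<l]"
proof (induction l arbitrary: k rule: less_induct)
  case (less l)
  show ?case
  proof (cases l)
    case (Suc m)
    have "tail_list (Suc k) (take (m - (3 * k + 1)) (map p [0..<l]))
        = map (tail p (Suc k)) [0..<m - (3 * k + 1)]"
      using less.IH[of "m - (3 * k + 1)" "Suc k"] Suc by (simp add: take_map del: upt_Suc)
    hence "tail_list k (map p [0..<l]) = shift_diff (3 * k + 2)
        (shift_diff (2 * k + 1) (map p [0..<l]) (map p [0..<l])) (map (tail p (Suc k)) [0..<m - (3 * k + 1)])"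
      unfolding Suc by (simp add: upt_conv_Cons del: upt_Suc)
    also have "\<dots> = map (tail p k) [0..<l]"
    proof (rule nth_equalityI, goal_cases)
      case (2 i)
      hence i: "i < l" by simp
      show ?case
        using i Suc tail.simps[of p k i] by (simp add: nth_shift_diff del: upt_Suc)
    qed simp
    finally show ?thesis .
  qed simp
qed

text \<open>
  By \<open>accum_tail\<close>, the values of \<open>tail (parts3 \<alpha> \<beta> \<gamma>) k\<close> are computed from the sparse series
  \<open>tail delta k\<close>, which is much faster than evaluating the recurrence on partition numbers.
\<close>
definition signs_ok :: "nat \<Rightarrow> nat \<Rightarrow> nat \<Rightarrow> nat \<Rightarrow> int list \<Rightarrow> nat \<Rightarrow> bool" where
  "signs_ok \<alpha> \<beta> \<gamma> k zs l = (let ys = parts3_list \<alpha> \<beta> \<gamma> (tail_list k (1 # replicate l 0)) in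
     map sgn (take (length zs) ys) = zs \<and> list_all (\<lambda>y. 0 < y) (drop (length zs) ys))"

lemma signs_ok_correct:
  assumes ok: "signs_ok \<alpha> \<beta> \<gamma> k zs l" and x: "x \<le> l" and pos: "\<alpha> > 0" "\<beta> > 0" "\<gamma> > 0"
  shows "sgn (tail (parts3 \<alpha> \<beta> \<gamma>) k x) = (if x < length zs then zs ! x else 1)"
proof -
  let ?p = "parts3 \<alpha> \<beta> \<gamma>"
  let ?ys = "map (tail ?p k) [0..<Suc l]"
  have ys: "parts3_list \<alpha> \<beta> \<gamma> (tail_list k (1 # replicate l 0)) = ?ys"
    unfolding delta_list tail_list_correct
    using pos by (simp only: parts3_list_correct accum_tail parts3_def)
  have *: "map sgn (take (length zs) ?ys) = zs" "list_all (\<lambda>y. 0 < y) (drop (length zs) ?ys)"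
    using ok unfolding signs_ok_def Let_def ys by blast+
  show ?thesis
  proof (cases "x < length zs")
    case True
    hence "zs ! x = map sgn (take (length zs) ?ys) ! x"
      using *(1) by simp
    thus ?thesis using True x by (simp del: upt_Suc)
  next
    case False
    hence "drop (length zs) ?ys ! (x - length zs) = tail ?p k x"
      using x by (simp del: upt_Suc)
    moreover have "x - length zs < length (drop (length zs) ?ys)"
      using x False by (auto simp del: upt_Suc)
    ultimately have "0 < tail ?p k x"
      using *(2) unfolding list_all_length by metis
    thus ?thesis using False by simp
  qed
qed

section \<open>The partition counts as quadratic quasi-polynomials\<close>

text \<open>By \<open>step\<close>, the function \<open>2 L p(x) - x^2 - s x\<close> has period
  \<open>L\<close>, so one period decides its bounds.\<close>

lemma quasi_periodic_bounds:
  fixes p :: "nat \<Rightarrow> int"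
  assumes L: "L > 0" and step: "\<And>x. 2 * (p (x + L) - p x) = 2 * int x + int L + s"
    and init: "\<And>x. x < L \<Longrightarrow> int x ^ 2 + s * int x - 13 \<le> 2 * int L * p x \<and>
      2 * int L * p x \<le> int x ^ 2 + s * int x + 84"
  shows "int x ^ 2 + s * int x - 13 \<le> 2 * int L * p x \<and>
      2 * int L * p x \<le> int x ^ 2 + s * int x + 84"
proof (induction x rule: less_induct)
  case (less x)
  show ?case
  proof (cases "x < L")
    case False
    define y where "y = x - L"
    have x: "x = y + L"
      using False by (simp add: y_def)
    have "int L * (2 * (p x - p y)) = int x ^ 2 + s * int x - (int y ^ 2 + s * int y)"
      unfolding x step by (simp add: algebra_simps power2_eq_square)
    moreover have "int L * (2 * (p x - p y)) = 2 * int L * p x - 2 * int L * p y"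
      by (simp add: algebra_simps)
    moreover have "y < x"
      using L x by simp
    ultimately show ?thesis
      using less.IH[of y] by linarith
  qed (rule init)
qed

text \<open>The period is \<open>l + 1\<close>, the number of entries of the input list.\<close>

definition bounds_ok :: "nat \<Rightarrow> nat \<Rightarrow> nat \<Rightarrow> int \<Rightarrow> nat \<Rightarrow> bool" where
  "bounds_ok \<alpha> \<beta> \<gamma> s l =
     list_all (\<lambda>(x, y). x * x + s * x - 13 \<le> 2 * (int l + 1) * y \<and> 2 * (int l + 1) * y \<le> x * x + s * x + 84)
       (zip [0..int l] (parts3_list \<alpha> \<beta> \<gamma> (1 # replicate l 0)))"

lemma bounds_ok_correct:
  assumes ok: "bounds_ok \<alpha> \<beta> \<gamma> s l" and x: "x < Suc l" and pos: "\<alpha> > 0" "\<beta> > 0" "\<gamma> > 0"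
  shows "int x ^ 2 + s * int x - 13 \<le> 2 * int (Suc l) * parts3 \<alpha> \<beta> \<gamma> x \<and>
      2 * int (Suc l) * parts3 \<alpha> \<beta> \<gamma> x \<le> int x ^ 2 + s * int x + 84"
proof -
  let ?ys = "map (parts3 \<alpha> \<beta> \<gamma>) [0..<Suc l]"
  have ys: "parts3_list \<alpha> \<beta> \<gamma> (1 # replicate l 0) = ?ys"
    unfolding delta_list using pos by (simp only: parts3_list_correct parts3_def)
  have "x < length (zip [0..int l] ?ys)"
    using x by simp
  moreover have "zip [0..int l] ?ys ! x = (int x, parts3 \<alpha> \<beta> \<gamma> x)"
    using x by (simp add: nth_upto del: upt_Suc)
  ultimately show ?thesis
    using ok unfolding bounds_ok_def ys list_all_length by (force simp: power2_eq_square algebra_simps)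
qed

lemma accum_1_delta: "accum 1 (\<lambda>n. if n = 0 then 1 else 0) = (\<lambda>_. 1)"
proof
  fix n
  show "accum 1 (\<lambda>n. if n = 0 then 1 else 0) n = 1"
  proof (induction n)
    case (Suc n)
    thus ?case using accum_rec[of 1 "\<lambda>n. if n = 0 then 1 else 0" "Suc n"] by simp
  qed (subst accum_rec; simp)
qed

lemma accum_2_delta: "accum 2 (\<lambda>n. if n = 0 then 1 else 0) = (\<lambda>n. of_bool (even n))"
proof
  fix n
  show "accum 2 (\<lambda>n. if n = 0 then 1 else 0) n = of_bool (even n)"
  proof (induction n rule: nat_induct2)
    case (step n)
    thus ?case using accum_rec[of 2 "\<lambda>n. if n = 0 then 1 else 0" "n + 2"] by simp
  qed (subst accum_rec; simp)+
qed

text \<open>Closed forms for the numbers of partitions into parts 1 and 4 and, next, into parts 2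
  and 3.\<close>

definition "parts_1_4 n = int (n div 4) + 1"
definition "parts_2_3 n = int (n div 6) + of_bool (n mod 6 \<noteq> 1)"

lemma parts_1_4_add: "parts_1_4 (4 * q + r) = int q + parts_1_4 r"
  by (simp add: parts_1_4_def)

lemma parts_2_3_add: "parts_2_3 (6 * q + r) = int q + parts_2_3 r"
  by (simp add: parts_2_3_def)

lemma mod_4_cases:
  fixes n :: nat
  obtains q r where "n = 4 * q + r" "r \<in> {0, 1, 2, 3}"
proof -
  have "n mod 4 < 4" "n = 4 * (n div 4) + n mod 4"
    by simp_all
  moreover have "n mod 4 \<in> {0, 1, 2, 3}"
    using \<open>n mod 4 < 4\<close> by auto
  ultimately show ?thesis
    using that[of "n div 4" "n mod 4"] by simp
qed

lemma mod_6_cases: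
  fixes n :: nat
  obtains q r where "n = 6 * q + r" "r \<in> {0, 1, 2, 3, 4, 5}"
proof -
  have "n mod 6 < 6" "n = 6 * (n div 6) + n mod 6"
    by simp_all
  moreover have "n mod 6 \<in> {0, 1, 2, 3, 4, 5}"
    using \<open>n mod 6 < 6\<close> by auto
  ultimately show ?thesis
    using that[of "n div 6" "n mod 6"] by simp
qed

lemma parts3_1_4: "parts3 1 4 \<gamma> = accum \<gamma> parts_1_4"
proof -
  have "accum 4 (\<lambda>_. 1) n = parts_1_4 n" for n
  proof (induction n rule: less_induct)
    case (less n)
    show ?case
    proof (cases "n < 4")
      case True
      thus ?thesis
        using accum_rec[of 4 "\<lambda>_. 1" n] by (simp add: parts_1_4_def)
    next
      case False
      thus ?thesis
        using less.IH[of "n - 4"] accum_rec[of 4 "\<lambda>_. 1" n] by (simp add: parts_1_4_def le_div_geq)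
    qed
  qed
  hence "accum 4 (\<lambda>_. 1) = parts_1_4"
    by (rule ext)
  thus ?thesis
    by (simp only: parts3_def accum_1_delta)
qed

lemma parts3_2_3: "parts3 2 3 \<gamma> = accum \<gamma> parts_2_3"
proof -
  let ?e = "\<lambda>n. of_bool (even n) :: int"
  have "accum 3 ?e n = parts_2_3 n" for n
  proof (induction n rule: less_induct)
    case (less n)
    show ?case
    proof (cases "n < 3")
      case True
      hence "accum 3 ?e n = ?e n"
        using accum_rec[of 3 ?e n] by simp
      moreover have "n = 0 \<or> n = 1 \<or> n = 2"
        using True by linarith
      ultimately show ?thesis
        by (auto simp: parts_2_3_def)
    next
      case False
      define m where "m = n - 3"
      have n: "n = m + 3" using False by (simp add: m_def)
      have "?e (m + 3) + parts_2_3 m = parts_2_3 (m + 3)"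
      proof -
        obtain q r where "m = 6 * q + r" "r \<in> {0, 1, 2, 3, 4, 5}"
          by (rule mod_6_cases)
        thus ?thesis
          by safe (simp_all add: parts_2_3_add add.assoc del: add_2_eq_Suc', simp_all add: parts_2_3_def)
      qed
      moreover have "accum 3 ?e n = ?e n + accum 3 ?e m"
        using accum_rec[of 3 ?e n] False by (simp add: m_def)
      ultimately show ?thesis
        using less.IH[of m] n by simp
    qed
  qed
  hence "accum 3 ?e = parts_2_3"
    by (rule ext)
  thus ?thesis
    by (simp only: parts3_def accum_2_delta)
qed

lemma accum_add: "d > 0 \<Longrightarrow> accum d f (n + d) = f (n + d) + accum d f n"
  by (subst accum_rec) simp_all

text \<open>Telescoping in four steps of 9 gives four values of \<open>parts_1_4\<close>. Their
  arguments meet every residue mod 4 once, so the periodic parts add up to a constant.\<close>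

lemma parts3_1_4_9_step: "2 * (parts3 1 4 9 (x + 36) - parts3 1 4 9 x) = 2 * int x + int 36 + 14"
proof -
  have "parts_1_4 (x + 36) + parts_1_4 (x + 27) + parts_1_4 (x + 18) + parts_1_4 (x + 9) = int x + 25"
  proof -
    obtain q r where "x = 4 * q + r" "r \<in> {0, 1, 2, 3}"
      by (rule mod_4_cases)
    thus ?thesis
      by (auto simp: parts_1_4_add add.assoc parts_1_4_def)
  qed
  thus ?thesis
    unfolding parts3_1_4 using accum_add[of 9 parts_1_4 "x + 27"] accum_add[of 9 parts_1_4 "x + 18"]
      accum_add[of 9 parts_1_4 "x + 9"] accum_add[of 9 parts_1_4 x] by (simp add: add.commute)
qed

text \<open>The same with six steps of 5 and the residues mod 6; the triple with 7 is
  analogous.\<close>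

lemma parts3_2_3_5_step: "2 * (parts3 2 3 5 (x + 30) - parts3 2 3 5 x) = 2 * int x + int 30 + 10"
proof -
  have "parts_2_3 (x + 30) + parts_2_3 (x + 25) + parts_2_3 (x + 20) + parts_2_3 (x + 15)
     + parts_2_3 (x + 10) + parts_2_3 (x + 5) = int x + 20"
  proof -
    obtain q r where "x = 6 * q + r" "r \<in> {0, 1, 2, 3, 4, 5}"
      by (rule mod_6_cases)
    thus ?thesis
      by safe (simp_all add: parts_2_3_add add.assoc, simp_all add: parts_2_3_def)
  qed
  thus ?thesis
    unfolding parts3_2_3 using accum_add[of 5 parts_2_3 "x + 25"] accum_add[of 5 parts_2_3 "x + 20"]
      accum_add[of 5 parts_2_3 "x + 15"] accum_add[of 5 parts_2_3 "x + 10"]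
      accum_add[of 5 parts_2_3 "x + 5"] accum_add[of 5 parts_2_3 x] by (simp add: add.commute)
qed

lemma parts3_2_3_7_step: "2 * (parts3 2 3 7 (x + 42) - parts3 2 3 7 x) = 2 * int x + int 42 + 12"
proof -
  have "parts_2_3 (x + 42) + parts_2_3 (x + 35) + parts_2_3 (x + 28) + parts_2_3 (x + 21)
     + parts_2_3 (x + 14) + parts_2_3 (x + 7) = int x + 27"
  proof -
    obtain q r where "x = 6 * q + r" "r \<in> {0, 1, 2, 3, 4, 5}"
      by (rule mod_6_cases)
    thus ?thesis
      by safe (simp_all add: parts_2_3_add add.assoc, simp_all add: parts_2_3_def)
  qed
  thus ?thesis
    unfolding parts3_2_3 using accum_add[of 7 parts_2_3 "x + 35"] accum_add[of 7 parts_2_3 "x + 28"]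
      accum_add[of 7 parts_2_3 "x + 21"] accum_add[of 7 parts_2_3 "x + 14"]
      accum_add[of 7 parts_2_3 "x + 7"] accum_add[of 7 parts_2_3 x] by (simp add: add.commute)
qed

section \<open>Positivity beyond explicit thresholds, joined with the computed values\<close>

text \<open>For \<open>k = 2, ..., 6\<close> the thresholds are \<open>pent b - pent k\<close> with
  \<open>b = 24, 13, 9, 8, 8\<close>, the least values from which on the inequality in
  \<open>tail_pos_if\<close> holds.\<close>

lemma tail_pos:
  fixes p :: "nat \<Rightarrow> int" and N s :: int
  assumes N: "N > 0" and p_0: "p 0 = 1" and s: "10 \<le> s" "s \<le> 14"
    and lower: "\<And>x. int x ^ 2 + s * int x - 13 \<le> N * p x"
    and upper: "\<And>x. N * p x \<le> int x ^ 2 + s * int x + 84"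
    and x: "k = 2 \<and> 869 \<le> x \<or> k = 3 \<and> 245 \<le> x \<or> k = 4 \<and> 100 \<le> x \<or> k = 5 \<and> 60 \<le> x \<or>
      k = 6 \<and> 43 \<le> x \<or> 7 \<le> k \<and> x \<noteq> 1"
  shows "tail p k x > 0"
proof -
  note tail_pos_if = tail_pos_if[OF N p_0 s lower upper]
  \<comment> \<open>The tangent to \<open>J^2\<close> at \<open>b\<close> makes the inequalities
    linear in \<open>J\<close>.\<close>
  have sq: "2 * b * J \<le> J ^ 2 + b ^ 2" for b J :: int
    using zero_le_power2[of "J - b"] by (simp add: algebra_simps power2_eq_square)
  consider "k = 2" "869 \<le> x" | "k = 3" "245 \<le> x" | "k = 4" "100 \<le> x" | "k = 5" "60 \<le> x" |
      "k = 6" "43 \<le> x" | "7 \<le> k" "x \<noteq> 1"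
    using x by blast
  thus ?thesis
  proof cases
    case 1
    show ?thesis
    proof (rule tail_pos_if[of 24])
      fix J :: int assume "24 \<le> J"
      thus "2 * J ^ 2 + 2 * J + 165 + 97 * (J - int k) < int k * (3 * (J ^ 2 - int k ^ 2) + J + 12)"
        using sq[of 24 J] 1 by simp
    qed (use 1 in \<open>simp_all add: pent_def\<close>)
  next
    case 2
    show ?thesis
    proof (rule tail_pos_if[of 13])
      fix J :: int assume "13 \<le> J"
      thus "2 * J ^ 2 + 2 * J + 165 + 97 * (J - int k) < int k * (3 * (J ^ 2 - int k ^ 2) + J + 12)"
        using sq[of 13 J] 2 by simp
    qed (use 2 in \<open>simp_all add: pent_def\<close>)
  next
    case 3
    show ?thesis
    proof (rule tail_pos_if[of 9])
      fix J :: int assume "9 \<le> J"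
      thus "2 * J ^ 2 + 2 * J + 165 + 97 * (J - int k) < int k * (3 * (J ^ 2 - int k ^ 2) + J + 12)"
        using sq[of 9 J] 3 by simp
    qed (use 3 in \<open>simp_all add: pent_def\<close>)
  next
    case 4
    show ?thesis
    proof (rule tail_pos_if[of 8])
      fix J :: int assume "8 \<le> J"
      thus "2 * J ^ 2 + 2 * J + 165 + 97 * (J - int k) < int k * (3 * (J ^ 2 - int k ^ 2) + J + 12)"
        using sq[of 8 J] 4 by simp
    qed (use 4 in \<open>simp_all add: pent_def\<close>)
  next
    case 5
    show ?thesis
    proof (rule tail_pos_if[of 8])
      fix J :: int assume "8 \<le> J"
      thus "2 * J ^ 2 + 2 * J + 165 + 97 * (J - int k) < int k * (3 * (J ^ 2 - int k ^ 2) + J + 12)"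
        using sq[of 8 J] 5 by simp
    qed (use 5 in \<open>simp_all add: pent_def\<close>)
  next
    case 6
    show ?thesis
      by (rule tail_pos_large_k[OF N p_0 s lower upper 6])
  qed
qed

lemma parts3_0: "\<alpha> > 0 \<Longrightarrow> \<beta> > 0 \<Longrightarrow> \<gamma> > 0 \<Longrightarrow> parts3 \<alpha> \<beta> \<gamma> 0 = 1"
  by (simp add: parts3_def accum_rec[of _ _ 0])

text \<open>The source of the infinite families of zeros: \<open>p 1\<close> is 0 when all parts
  exceed 1.\<close>

lemma tail_1: "k \<ge> 1 \<Longrightarrow> tail p k 1 = p 1"
  by (subst tail.simps) auto

text \<open>The computed lists end just below the thresholds of \<open>tail_pos\<close>.
  \<open>zs\<close> holds the initial signs for \<open>k = 2\<close>; for larger \<open>k\<close>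
  only the sign \<open>z\<close> at \<open>x = 1\<close> can be exceptional.\<close>

lemma sgn_tail:
  assumes pos: "\<alpha> > 0" "\<beta> > 0" "\<gamma> > 0" and s: "10 \<le> s" "s \<le> 14"
    and step: "\<And>x. 2 * (parts3 \<alpha> \<beta> \<gamma> (x + Suc l) - parts3 \<alpha> \<beta> \<gamma> x) = 2 * int x + int (Suc l) + s"
    and bounds: "bounds_ok \<alpha> \<beta> \<gamma> s l"
    and signs2: "signs_ok \<alpha> \<beta> \<gamma> 2 zs 868" and signs3: "signs_ok \<alpha> \<beta> \<gamma> 3 [1, z] 244"
    and signs4: "signs_ok \<alpha> \<beta> \<gamma> 4 [1, z] 99" and signs5: "signs_ok \<alpha> \<beta> \<gamma> 5 [1, z] 59"
    and signs6: "signs_ok \<alpha> \<beta> \<gamma> 6 [1, z] 42"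
    and len: "length zs \<le> 869" and k: "k \<ge> 2"
  shows "sgn (tail (parts3 \<alpha> \<beta> \<gamma>) k x) =
    (if k = 2 then if x < length zs then zs ! x else 1 else if x = 1 then z else 1)"
proof -
  let ?p = "parts3 \<alpha> \<beta> \<gamma>"
  have bnd: "int x ^ 2 + s * int x - 13 \<le> 2 * int (Suc l) * ?p x \<and>
      2 * int (Suc l) * ?p x \<le> int x ^ 2 + s * int x + 84" for x
    by (rule quasi_periodic_bounds[OF _ step]) (use bounds_ok_correct[OF bounds _ pos] in auto)
  have large: "sgn (tail ?p k x) = 1" if
    "k = 2 \<and> 869 \<le> x \<or> k = 3 \<and> 245 \<le> x \<or> k = 4 \<and> 100 \<le> x \<or> k = 5 \<and> 60 \<le> x \<or>
      k = 6 \<and> 43 \<le> x \<or> 7 \<le> k \<and> x \<noteq> 1"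
    using tail_pos[of "2 * int (Suc l)" ?p s k x] bnd parts3_0[OF pos] s that by simp
  have two: "(if y < length [1, z] then [1, z] ! y else 1) = (if y = 1 then z else 1)" for y
    by (auto simp: less_Suc_eq)
  note correct = signs_ok_correct[OF _ _ pos, of _ "[1, z]", unfolded two]
  consider "k = 2" | "k = 3" | "k = 4" | "k = 5" | "k = 6" | "k \<ge> 7"
    using k by linarith
  thus ?thesis
  proof cases
    case 1
    thus ?thesis
      using signs_ok_correct[OF signs2 _ pos, of x] large len by (cases "x \<le> 868") auto
  next
    case 2
    thus ?thesis
      using correct[OF signs3] large by (cases "x \<le> 244") auto
  next
    case 3
    thus ?thesis
      using correct[OF signs4] large by (cases "x \<le> 99") auto
  next
    case 4
    thus ?thesis
      using correct[OF signs5] large by (cases "x \<le> 59") auto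
  next
    case 5
    thus ?thesis
      using correct[OF signs6] large by (cases "x \<le> 42") auto
  next
    case 6
    \<comment> \<open>By \<open>tail_1\<close> the value at 1 is the same on all levels, so the list
      for \<open>k = 3\<close> determines it.\<close>
    have "sgn (?p 1) = z"
      using signs_ok_correct[OF signs3 _ pos, of 1] tail_1[of 3 ?p] by simp
    thus ?thesis
      using 6 large tail_1[of k ?p] by auto
  qed
qed

section \<open>The three triples\<close>

text \<open>The zeros sit at \<open>n - 7\<close>, as \<open>pent 2 = 7\<close>. The parameters are
  \<open>s = 1 + 4 + 9\<close> and \<open>l + 1 = 1 * 4 * 9\<close>.\<close>

lemma sgn_tail_1_4_9:
  assumes "k \<ge> 2"
  shows "sgn (tail (parts3 1 4 9) k x) = (if k = 2 \<and> x \<in> {14, 17, 18} then 0 else 1)"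
proof -
  let ?zs = "[1, 1, 1, 1, 1, 1, 1, 1, 1, 1, 1, 1, 1, 1, 0, 1, 1, 0, 0] :: int list"
  have "sgn (tail (parts3 1 4 9) k x) =
      (if k = 2 then if x < length ?zs then ?zs ! x else 1 else if x = 1 then 1 else 1)"
  proof (rule sgn_tail[where s = 14 and l = 35])
    show "2 * (parts3 1 4 9 (x + Suc 35) - parts3 1 4 9 x) = 2 * int x + int (Suc 35) + 14" for x
      using parts3_1_4_9_step[of x] by simp
    show "bounds_ok 1 4 9 14 35" by code_simp
    show "signs_ok 1 4 9 2 ?zs 868" by code_simp
    show "signs_ok 1 4 9 3 [1, 1] 244" by code_simp
    show "signs_ok 1 4 9 4 [1, 1] 99" by code_simp
    show "signs_ok 1 4 9 5 [1, 1] 59" by code_simp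
    show "signs_ok 1 4 9 6 [1, 1] 42" by code_simp
  qed (use assms in simp_all)
  thus ?thesis
    by (auto simp: nth_append nth_Cons' split: if_splits)
qed

lemma sgn_tail_2_3_5:
  assumes "k \<ge> 2"
  shows "sgn (tail (parts3 2 3 5) k x) = (if k = 2 \<and> x \<in> {13, 16} \<or> x = 1 then 0 else 1)"
proof -
  let ?zs = "[1, 0, 1, 1, 1, 1, 1, 1, 1, 1, 1, 1, 1, 0, 1, 1, 0] :: int list"
  have "sgn (tail (parts3 2 3 5) k x) =
      (if k = 2 then if x < length ?zs then ?zs ! x else 1 else if x = 1 then 0 else 1)"
  proof (rule sgn_tail[where s = 10 and l = 29])
    show "2 * (parts3 2 3 5 (x + Suc 29) - parts3 2 3 5 x) = 2 * int x + int (Suc 29) + 10" for x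
      using parts3_2_3_5_step[of x] by simp
    show "bounds_ok 2 3 5 10 29" by code_simp
    show "signs_ok 2 3 5 2 ?zs 868" by code_simp
    show "signs_ok 2 3 5 3 [1, 0] 244" by code_simp
    show "signs_ok 2 3 5 4 [1, 0] 99" by code_simp
    show "signs_ok 2 3 5 5 [1, 0] 59" by code_simp
    show "signs_ok 2 3 5 6 [1, 0] 42" by code_simp
  qed (use assms in simp_all)
  thus ?thesis
    by (auto simp: nth_append nth_Cons' split: if_splits)
qed

lemma sgn_tail_2_3_7:
  assumes "k \<ge> 2"
  shows "sgn (tail (parts3 2 3 7) k x) = (if k = 2 \<and> x \<in> {5, 8, 11, 14, 17, 20} \<or> x = 1 then 0 else 1)"
proof -
  let ?zs = "[1, 0, 1, 1, 1, 0, 1, 1, 0, 1, 1, 0, 1, 1, 0, 1, 1, 0, 1, 1, 0] :: int list"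
  have "sgn (tail (parts3 2 3 7) k x) =
      (if k = 2 then if x < length ?zs then ?zs ! x else 1 else if x = 1 then 0 else 1)"
  proof (rule sgn_tail[where s = 12 and l = 41])
    show "2 * (parts3 2 3 7 (x + Suc 41) - parts3 2 3 7 x) = 2 * int x + int (Suc 41) + 12" for x
      using parts3_2_3_7_step[of x] by simp
    show "bounds_ok 2 3 7 12 41" by code_simp
    show "signs_ok 2 3 7 2 ?zs 868" by code_simp
    show "signs_ok 2 3 7 3 [1, 0] 244" by code_simp
    show "signs_ok 2 3 7 4 [1, 0] 99" by code_simp
    show "signs_ok 2 3 7 5 [1, 0] 59" by code_simp
    show "signs_ok 2 3 7 6 [1, 0] 42" by code_simp
  qed (use assms in simp_all)
  thus ?thesis
    by (auto simp: nth_append nth_Cons' split: if_splits)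
qed

theorem theorem1p2:
  fixes \<alpha> \<beta> \<gamma> k n :: nat
  assumes "(\<alpha>, \<beta>, \<gamma>) \<in> {(1, 4, 9), (2, 3, 5), (2, 3, 7)}"
    and "k \<ge> 2" and "n \<ge> k * (3 * k + 1) div 2"
  shows "TP \<alpha> \<beta> \<gamma> k n \<ge> 0 \<and>
    (TP \<alpha> \<beta> \<gamma> k n = 0 \<longleftrightarrow>
       (\<alpha>, \<beta>, \<gamma>) = (1, 4, 9) \<and> k = 2 \<and> n \<in> {21, 24, 25} \<or>
       (\<alpha>, \<beta>, \<gamma>) = (2, 3, 5) \<and>
         (k = 2 \<and> n \<in> {20, 23} \<or> n = k * (3 * k + 1) div 2 + 1) \<or>
       (\<alpha>, \<beta>, \<gamma>) = (2, 3, 7) \<and>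
         (k = 2 \<and> (\<exists>j. 4 \<le> j \<and> j \<le> 9 \<and> n = 3 * j) \<or> n = k * (3 * k + 1) div 2 + 1))"
proof -
  define x where "x = n - pent k"
  have n: "n = pent k + x" and pent_k: "k * (3 * k + 1) div 2 = pent k"
    using assms(3) by (simp_all add: x_def pent_def)
  have sgn_iff: "t \<ge> 0 \<and> (t = 0 \<longleftrightarrow> Q)" if "sgn t = (if Q then 0 else 1)" for t :: int and Q
    using that by (auto simp: sgn_if split: if_splits)
  have pent_2: "pent 2 = 7"
    by (simp add: pent_def)
  consider "(\<alpha>, \<beta>, \<gamma>) = (1, 4, 9)" | "(\<alpha>, \<beta>, \<gamma>) = (2, 3, 5)" | "(\<alpha>, \<beta>, \<gamma>) = (2, 3, 7)"
    using assms(1) by blast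
  thus ?thesis
  proof cases
    case 1
    have "TP \<alpha> \<beta> \<gamma> k n = tail (parts3 1 4 9) k x"
      using 1 by (simp add: n TP_eq_tail)
    moreover have "k = 2 \<and> x \<in> {14, 17, 18} \<longleftrightarrow> k = 2 \<and> n \<in> {21, 24, 25}"
      by (auto simp: n pent_2)
    ultimately show ?thesis
      using sgn_iff[OF sgn_tail_1_4_9[OF assms(2), of x]] 1 by simp
  next
    case 2
    have "TP \<alpha> \<beta> \<gamma> k n = tail (parts3 2 3 5) k x"
      using 2 by (simp add: n TP_eq_tail)
    moreover have "k = 2 \<and> x \<in> {13, 16} \<or> x = 1 \<longleftrightarrow>
        k = 2 \<and> n \<in> {20, 23} \<or> n = k * (3 * k + 1) div 2 + 1"
      unfolding pent_k by (auto simp: n pent_2)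
    ultimately show ?thesis
      using sgn_iff[OF sgn_tail_2_3_5[OF assms(2), of x]] 2 by simp
  next
    case 3
    have "TP \<alpha> \<beta> \<gamma> k n = tail (parts3 2 3 7) k x"
      using 3 by (simp add: n TP_eq_tail)
    \<comment> \<open>For \<open>k = 2\<close>, \<open>7 + x\<close> is \<open>n\<close>, and the
      multiples of 3 in question run from 12 to 27.\<close>
    moreover have "(\<exists>j. 4 \<le> j \<and> j \<le> 9 \<and> 7 + x = 3 * j) \<longleftrightarrow> x \<in> {5, 8, 11, 14, 17, 20}"
    proof
      assume "\<exists>j. 4 \<le> j \<and> j \<le> 9 \<and> 7 + x = 3 * j"
      then obtain j where "4 \<le> j" "j \<le> 9" "7 + x = 3 * j"
        by blast
      moreover from this have "j \<in> {4, 5, 6, 7, 8, 9}"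
        by auto
      ultimately show "x \<in> {5, 8, 11, 14, 17, 20}"
        by auto
    next
      assume "x \<in> {5, 8, 11, 14, 17, 20}"
      thus "\<exists>j. 4 \<le> j \<and> j \<le> 9 \<and> 7 + x = 3 * j"
        by (intro exI[of _ "(7 + x) div 3"]) auto
    qed
    hence "k = 2 \<and> x \<in> {5, 8, 11, 14, 17, 20} \<or> x = 1 \<longleftrightarrow>
        k = 2 \<and> (\<exists>j. 4 \<le> j \<and> j \<le> 9 \<and> n = 3 * j) \<or> n = k * (3 * k + 1) div 2 + 1"
      unfolding pent_k by (auto simp: n pent_2)
    ultimately show ?thesis
      using sgn_iff[OF sgn_tail_2_3_7[OF assms(2), of x]] 3 by simp
  qed
qed

end
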